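(* Let $g\geq 1$ be an integer, let $G=\mathrm{Sp}(2g,\mathbb{Z})$, and let $\mathcal{A}$ be the set of all positive integers $m$ such that $p\leq 2g+1$ for some prime divisor $p$ of $m$. For every positive integer $m$, there exists a matrix $A\in G$ with $A\neq I$ and $A^{m}=I$ if and only if $m\in\mathcal{A}$.
   Context: $\mathrm{Sp}(2g,\mathbb{Z})$ is the group of all $2g\times 2g$ matrices $A$ with integer entries satisfying $A^{\top}JA=J$, where $J=\begin{pmatrix}0_{g} & I_{g}\\ -I_{g} & 0_{g}\end{pmatrix}$. $I$ denotes the identity matrix. *)

theory Defs
  imports "Jordan_Normal_Form.Matrix" "HOL-Computational_Algebra.Primes"
begin

definition symp_form :: "nat \<Rightarrow> int mat" where
  "symp_form g = four_block_mat (0\<^sub>m g g) (1\<^sub>m g) (- 1\<^sub>m g) (0\<^sub>m g g)"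

definition Sp_int :: "nat \<Rightarrow> int mat set" where
  "Sp_int g = {A \<in> carrier_mat (2 * g) (2 * g). transpose_mat A * symp_form g * A = symp_form g}"

definition admissible_exponents :: "nat \<Rightarrow> nat set" where
  "admissible_exponents g = {m. m > 0 \<and> (\<exists>p. prime p \<and> p dvd m \<and> p \<le> 2 * g + 1)}"

end

theory Submission
  imports Defs "Berlekamp_Zassenhaus.Factor_Bound"
begin

text \<open>
  The claim is that \<open>Sp(2g, \<int>)\<close> has an element of prime order \<open>p\<close> exactly when
  \<open>p \<le> 2g + 1\<close>. This suffices: if \<open>A \<noteq> I\<close> and \<open>A\<^sup>m = I\<close>, then some power of \<open>A\<close> has prime
  order \<open>q\<close> with \<open>q\<close> dividing \<open>m\<close> (\<open>prime_order_power\<close>), and an element of order \<open>p\<close> is killed by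
  every multiple of \<open>p\<close>.

  The upper bound is a fact about rational matrices (\<open>prime_order_mat_bound\<close>). Let \<open>B\<close> be a
  rational \<open>N \<times> N\<close> matrix of prime order \<open>q\<close>. An entry of \<open>B - I\<close> that is not zero gives the
  rational sequence \<open>a\<^sub>n = (B\<^sup>n\<^sup>+\<^sup>1 - B\<^sup>n)\<^sub>r\<^sub>s\<close> with \<open>a\<^sub>0 \<noteq> 0\<close>. Polynomials act on sequences, with the
  variable acting as the shift. The polynomial \<open>1 + x + \<dots> + x\<^sup>q\<^sup>-\<^sup>1\<close> kills the sequence because the
  sum telescopes to \<open>B\<^sup>n\<^sup>+\<^sup>q - B\<^sup>n = 0\<close>; and since any \<open>N + 1\<close> vectors of length \<open>N\<close> are linearly
  dependent, some nonzero polynomial of degree at most \<open>N\<close> kills it as well. If \<open>N < q - 1\<close>, the two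
  polynomials are coprime, because the first one is irreducible over the rationals (Eisenstein's
  criterion after \<open>x \<mapsto> x + 1\<close>, and Gauss's lemma). By Bezout's identity the polynomial \<open>1\<close> then
  kills the sequence, which contradicts \<open>a\<^sub>0 \<noteq> 0\<close>.

  For the construction, \<open>- I\<close> has order \<open>2\<close>. Let \<open>p = 2k + 1\<close> with \<open>1 \<le> k \<le> g\<close>. Take the lattice
  with basis \<open>e\<^sub>0, \<dots>, e\<^sub>2\<^sub>k\<^sub>-\<^sub>1\<close> and the alternating form with \<open>\<langle>e\<^sub>i, e\<^sub>i\<^sub>+\<^sub>1\<rangle> = 1\<close> and
  \<open>\<langle>e\<^sub>i, e\<^sub>j\<rangle> = 0\<close> for \<open>\<bar>i - j\<bar> > 1\<close> (a chain of \<open>2k\<close> curves on a surface of genus \<open>k\<close>), and put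
  \<open>e\<^sub>2\<^sub>k = - (e\<^sub>0 + \<dots> + e\<^sub>2\<^sub>k\<^sub>-\<^sub>1)\<close>. Then also \<open>\<langle>e\<^sub>2\<^sub>k\<^sub>-\<^sub>1, e\<^sub>2\<^sub>k\<rangle> = \<langle>e\<^sub>2\<^sub>k, e\<^sub>0\<rangle> = 1\<close>, and \<open>e\<^sub>2\<^sub>k\<close> is
  orthogonal to the other \<open>e\<^sub>i\<close>, so the cyclic permutation \<open>e\<^sub>i \<mapsto> e\<^sub>i\<^sub>+\<^sub>1\<close> of these \<open>2k + 1\<close> vectors
  preserves the form and has order \<open>2k + 1\<close>. The vectors \<open>a\<^sub>i = e\<^sub>0 + e\<^sub>2 + \<dots> + e\<^sub>2\<^sub>i\<close> and
  \<open>b\<^sub>i = e\<^sub>2\<^sub>i\<^sub>+\<^sub>1\<close> form a symplectic basis; the matrix of the permutation in it, extended by the identity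
  on \<open>a\<^sub>i, b\<^sub>i\<close> for \<open>k \<le> i < g\<close>, is \<open>chain_rotation g k\<close>.
\<close>

section \<open>Powers of square matrices\<close>

lemma pow_mat_add:
  fixes A :: "'a::semiring_1 mat"
  assumes A: "A \<in> carrier_mat n n"
  shows "A ^\<^sub>m (i + j) = A ^\<^sub>m i * A ^\<^sub>m j"
proof -
  interpret semiring "ring_mat TYPE('a) n b"
    by (rule semiring_mat)
  show ?thesis
    using nat_pow_mult[of A i j] A by (simp add: pow_mat_ring_pow[OF A, of _ b] ring_mat_simps)
qed

lemma pow_mat_mult:
  fixes A :: "'a::semiring_1 mat"
  assumes A: "A \<in> carrier_mat n n"
  shows "A ^\<^sub>m (i * j) = (A ^\<^sub>m i) ^\<^sub>m j"
  using A by (induction j) (simp_all add: pow_mat_add[OF A] add.commute[of i])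

lemma one_pow_mat: "(1\<^sub>m n :: 'a::semiring_1 mat) ^\<^sub>m k = 1\<^sub>m n"
  by (induction k) simp_all

text \<open>
  Write \<open>m = k q\<close> with \<open>q\<close> prime. Either \<open>A\<^sup>k\<close> is the required power, or \<open>A\<^sup>k = I\<close> and \<open>m\<close> can be
  replaced by the smaller exponent \<open>k\<close>.
\<close>
lemma prime_order_power:
  fixes A :: "'a::semiring_1 mat"
  assumes A: "A \<in> carrier_mat n n" and m: "m > 0" and Am: "A ^\<^sub>m m = 1\<^sub>m n" and A1: "A \<noteq> 1\<^sub>m n"
  obtains q k where "prime q" "q dvd m" "A ^\<^sub>m k \<noteq> 1\<^sub>m n" "(A ^\<^sub>m k) ^\<^sub>m q = 1\<^sub>m n"
  using m Am
proof (induction m arbitrary: thesis rule: less_induct)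
  case (less m)
  have "m \<noteq> 1"
    using less.prems A A1 by auto
  then obtain q where q: "prime q" "q dvd m"
    using prime_factor_nat by blast
  then obtain k where m: "m = k * q"
    by (auto elim: dvdE simp: mult.commute)
  show thesis
  proof (cases "A ^\<^sub>m k = 1\<^sub>m n")
    case False
    thus thesis
      using less.prems q by (simp add: m pow_mat_mult[OF A])
  next
    case True
    have "0 < k" "k < m"
      using less.prems(2) prime_gt_1_nat[OF q(1)] by (auto simp: m)
    thus thesis
      using less.IH[of k] True less.prems(1) by (metis dvd_triv_left dvd_trans m)
  qed
qed

section \<open>Irreducibility of the prime cyclotomic polynomial\<close>

text \<open>
  In a factorization \<open>p = f g\<close> the prime \<open>q\<close> divides exactly one of the constant terms, say that of
  \<open>f\<close>. At the first index where \<open>q\<close> does not divide the coefficient of \<open>f\<close>, the coefficient of \<open>f g\<close>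
  is not divisible by \<open>q\<close> either, so this index is at least the degree of \<open>p\<close>, which exceeds that
  of \<open>f\<close>.
\<close>
lemma irreducible\<^sub>d_Eisenstein:
  fixes p :: "int poly" and q :: int
  assumes q: "prime q" and deg: "degree p > 0"
    and lead: "\<not> q dvd lead_coeff p"
    and low: "\<And>i. i < degree p \<Longrightarrow> q dvd coeff p i"
    and const: "\<not> q\<^sup>2 dvd coeff p 0"
  shows "irreducible\<^sub>d p"
proof (rule irreducible\<^sub>dI[OF deg])
  have no_factor: False
    if fg: "p = f * g" and df: "degree f < degree p" and qf: "q dvd coeff f 0"
      and qg: "\<not> q dvd coeff g 0" for f g :: "int poly"
  proof -
    have "lead_coeff p = lead_coeff f * lead_coeff g"
      using fg by (simp add: lead_coeff_mult)
    hence ex: "\<not> q dvd coeff f (degree f)"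
      using lead by auto
    define i where "i = (LEAST i. \<not> q dvd coeff f i)"
    have qi: "\<not> q dvd coeff f i"
      unfolding i_def using ex by (rule LeastI)
    have below: "q dvd coeff f j" if "j < i" for j
      using that not_less_Least unfolding i_def by blast
    have "i \<le> degree f"
      unfolding i_def using ex by (rule Least_le)
    hence "q dvd coeff p i"
      using low df by simp
    moreover have "coeff p i = (\<Sum>j<i. coeff f j * coeff g (i - j)) + coeff f i * coeff g 0"
      unfolding fg coeff_mult by (simp add: lessThan_Suc_atMost[symmetric])
    moreover have "q dvd (\<Sum>j<i. coeff f j * coeff g (i - j))"
      using below by (intro dvd_sum) auto
    ultimately have "q dvd coeff f i * coeff g 0"
      by (simp add: dvd_add_right_iff)
    thus False
      using qi qg q by (simp add: prime_dvd_mult_iff)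
  qed
  fix f g :: "int poly"
  assume d: "degree f < degree p" "degree g < degree p" and fg: "p = f * g"
  have c0: "coeff p 0 = coeff f 0 * coeff g 0"
    using fg by (simp add: coeff_mult)
  hence "q dvd coeff f 0 \<or> q dvd coeff g 0"
    using low[OF deg] q by (simp add: prime_dvd_mult_iff)
  moreover have "\<not> (q dvd coeff f 0 \<and> q dvd coeff g 0)"
    using const mult_dvd_mono[of q "coeff f 0" q "coeff g 0"] unfolding c0 power2_eq_square by blast
  ultimately show False
    using no_factor[of f g] no_factor[of g f] d fg by (auto simp: mult.commute)
qed

text \<open>
  For a prime \<open>q\<close> this is the \<open>q\<close>-th cyclotomic polynomial.
\<close>
definition geometric_poly :: "nat \<Rightarrow> 'a::comm_semiring_1 poly" where
  "geometric_poly q = (\<Sum>i<q. monom 1 i)"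

lemma coeff_geometric_poly: "coeff (geometric_poly q) i = (if i < q then 1 else 0)"
  by (simp add: geometric_poly_def coeff_sum)

lemma degree_geometric_poly: "degree (geometric_poly q :: 'a::comm_semiring_1 poly) = q - 1"
proof (rule antisym)
  show "degree (geometric_poly q :: 'a poly) \<le> q - 1"
    by (rule degree_le) (auto simp: coeff_geometric_poly)
  show "q - 1 \<le> degree (geometric_poly q :: 'a poly)"
    by (cases q) (auto intro!: le_degree simp: coeff_geometric_poly)
qed

text \<open>
  Substituting \<open>x + 1\<close> into \<open>(x\<^sup>q - 1) / (x - 1)\<close> gives \<open>((x + 1)\<^sup>q - 1) / x\<close>, whose coefficients
  are binomial coefficients.
\<close>
lemma coeff_geometric_poly_translate:
  "coeff (geometric_poly q \<circ>\<^sub>p [:1, 1:] :: int poly) i = int (q choose Suc i)"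
proof -
  have "geometric_poly q \<circ>\<^sub>p [:1, 1:] = (\<Sum>j<q. [:1, 1:] ^ j :: int poly)"
    by (simp add: geometric_poly_def pcompose_sum monom_altdef pcompose_hom.hom_power
        pcompose_smult pcompose_pCons)
  moreover have "[:0, 1:] = [:1, 1:] - (1 :: int poly)"
    by (simp only: one_pCons diff_pCons) simp
  ultimately have "[:0, 1:] * (geometric_poly q \<circ>\<^sub>p [:1, 1:]) = [:1, 1:] ^ q - (1 :: int poly)"
    by (simp only: power_diff_1_eq)
  hence "coeff ([:0, 1:] * (geometric_poly q \<circ>\<^sub>p [:1, 1:])) (Suc i)
    = coeff ([:1, 1:] ^ q - (1 :: int poly)) (Suc i)"
    by simp
  moreover have "coeff ([:1, 1:] ^ q) (Suc i) = int (q choose Suc i)"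
  proof (cases "Suc i \<le> q")
    case True
    thus ?thesis
      using coeff_linear_poly_power[OF True, of "1 :: int" 1] by simp
  next
    case False
    thus ?thesis
      using coeff_eq_0[of "[:1, 1:] ^ q :: int poly" "Suc i"] degree_linear_power[of "1 :: int" q] by simp
  qed
  ultimately show ?thesis
    by simp
qed

text \<open>
  After the substitution the constant term is \<open>q\<close>, the other coefficients below the leading one are
  divisible by \<open>q\<close>, and Eisenstein's criterion applies. A factorization of the original polynomial
  would be carried over by the substitution.
\<close>
lemma irreducible\<^sub>d_geometric_poly:
  assumes q: "prime q"
  shows "irreducible\<^sub>d (geometric_poly q :: int poly)"
proof -
  let ?h = "geometric_poly q \<circ>\<^sub>p [:1, 1:] :: int poly"
  have q1: "q > 1"
    using q by (rule prime_gt_1_nat)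
  have deg: "degree ?h = q - 1"
    by (simp add: degree_pcompose degree_geometric_poly)
  have "irreducible\<^sub>d ?h"
  proof (rule irreducible\<^sub>d_Eisenstein[of "int q"])
    show "int q dvd coeff ?h i" if "i < degree ?h" for i
      using that q dvd_choose_prime[of "Suc i" q] unfolding deg coeff_geometric_poly_translate by simp
    show "\<not> (int q)\<^sup>2 dvd coeff ?h 0"
      using q1 unfolding coeff_geometric_poly_translate by (simp add: power2_eq_square)
    show "\<not> int q dvd lead_coeff ?h"
      using q1 unfolding deg coeff_geometric_poly_translate by simp
    show "degree ?h > 0"
      using q1 unfolding deg by simp
  qed (use q in simp)
  show ?thesis
  proof (rule irreducible\<^sub>dI)
    fix f g :: "int poly"
    assume d: "degree f < degree (geometric_poly q :: int poly)"
      "degree g < degree (geometric_poly q :: int poly)" and fg: "geometric_poly q = f * g"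
    have "?h = (f \<circ>\<^sub>p [:1, 1:]) * (g \<circ>\<^sub>p [:1, 1:])"
      unfolding fg by (rule pcompose_mult)
    moreover have "degree (f \<circ>\<^sub>p [:1, 1:]) < degree ?h" "degree (g \<circ>\<^sub>p [:1, 1:]) < degree ?h"
      using d by simp_all
    ultimately show False
      using irreducible\<^sub>dD(2)[OF \<open>irreducible\<^sub>d ?h\<close>] by blast
  qed (use q1 in \<open>simp add: degree_geometric_poly\<close>)
qed

lemma gcd_geometric_poly:
  fixes f :: "rat poly"
  assumes q: "prime q" and f: "f \<noteq> 0" "degree f < q - 1"
  shows "gcd (geometric_poly q) f = 1"
proof -
  have "map_poly rat_of_int (geometric_poly q) = geometric_poly q"
    by (rule poly_eqI) (simp add: coeff_geometric_poly)
  hence "irreducible\<^sub>d (geometric_poly q :: rat poly)"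
    using irreducible\<^sub>d_int_rat[OF irreducible\<^sub>d_geometric_poly[OF q]] by simp
  hence "irreducible (geometric_poly q :: rat poly)"
    by simp
  hence "prime_elem (geometric_poly q :: rat poly)"
    by (rule irreducible_imp_prime_elem_gcd)
  moreover have "\<not> geometric_poly q dvd f"
    using f dvd_imp_degree_le[of "geometric_poly q" f] by (auto simp: degree_geometric_poly)
  ultimately show ?thesis
    by (simp add: prime_elem_imp_coprime coprime_imp_gcd_eq_1)
qed

section \<open>Polynomials in the shift operator\<close>

text \<open>
  The polynomial \<open>f\<close> acts on the sequence \<open>a\<close>, the variable acting as the shift \<open>a\<^sub>n \<mapsto> a\<^sub>n\<^sub>+\<^sub>1\<close>.
  Thus \<open>a\<close> satisfies the linear recurrence with characteristic polynomial \<open>f\<close> iff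
  \<open>shift_poly f a\<close> vanishes.
\<close>
definition shift_poly :: "'a::comm_ring_1 poly \<Rightarrow> (nat \<Rightarrow> 'a) \<Rightarrow> nat \<Rightarrow> 'a" where
  "shift_poly f a n = (\<Sum>i\<le>degree f. coeff f i * a (n + i))"

lemma shift_poly_altdef:
  assumes "degree f \<le> d"
  shows "shift_poly f a n = (\<Sum>i\<le>d. coeff f i * a (n + i))"
  unfolding shift_poly_def using assms
  by (intro sum.mono_neutral_left) (auto simp: coeff_eq_0)

lemma shift_poly_0 [simp]: "shift_poly 0 a n = 0"
  by (simp add: shift_poly_def)

lemma shift_poly_1 [simp]: "shift_poly 1 a n = a n"
  by (simp add: shift_poly_def)

lemma shift_poly_zero_seq [simp]: "shift_poly f (\<lambda>_. 0) n = 0"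
  by (simp add: shift_poly_def)

lemma shift_poly_add: "shift_poly (f + g) a n = shift_poly f a n + shift_poly g a n"
proof -
  let ?d = "max (degree f) (degree g)"
  have "degree (f + g) \<le> ?d"
    by (rule degree_add_le_max)
  thus ?thesis
    by (simp add: shift_poly_altdef[of _ ?d] sum.distrib algebra_simps)
qed

lemma shift_poly_smult: "shift_poly (smult c f) a n = c * shift_poly f a n"
  using degree_smult_le[of c f]
  by (simp add: shift_poly_altdef[of _ "degree f"] sum_distrib_left algebra_simps)

lemma shift_poly_pCons: "shift_poly (pCons c f) a n = c * a n + shift_poly f a (Suc n)"
  by (simp add: shift_poly_altdef[of "pCons c f" "Suc (degree f)"] degree_pCons_le
      sum.atMost_Suc_shift shift_poly_def del: sum.atMost_Suc)

text \<open>
  Sequences thus form a module over the polynomial ring, and the polynomials that annihilate a given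
  sequence form an ideal.
\<close>
lemma shift_poly_mult: "shift_poly (f * g) a n = shift_poly f (shift_poly g a) n"
proof (induction f arbitrary: n)
  case (pCons c f)
  have "pCons c f * g = smult c g + pCons 0 (f * g)"
    by simp
  thus ?case
    by (simp only: shift_poly_add shift_poly_smult shift_poly_pCons pCons.IH) simp
qed simp

text \<open>
  The annihilator of \<open>a\<close> contains two coprime polynomials, hence \<open>1\<close>.
\<close>
lemma geometric_recurrence_imp_zero:
  fixes a :: "nat \<Rightarrow> rat"
  assumes q: "prime q" and f: "f \<noteq> 0" "degree f < q - 1"
    and geometric: "\<And>n. (\<Sum>i<q. a (n + i)) = 0"
    and annihilated: "\<And>n. shift_poly f a n = 0"
  shows "a n = 0"
proof -
  let ?G = "geometric_poly q :: rat poly"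
  obtain u v where uv: "u * ?G + v * f = 1"
    using bezout_coefficients_fst_snd[of ?G f] unfolding gcd_geometric_poly[OF q f] by blast
  have "{..q - 1} = {..<q}"
    using prime_gt_0_nat[OF q] by auto
  hence G0: "shift_poly ?G a = (\<lambda>_. 0)"
    using geometric by (auto simp: shift_poly_def degree_geometric_poly coeff_geometric_poly fun_eq_iff)
  have f0: "shift_poly f a = (\<lambda>_. 0)"
    using annihilated by auto
  have "a n = shift_poly (u * ?G + v * f) a n"
    by (simp add: uv)
  also have "\<dots> = 0"
    by (simp add: shift_poly_add shift_poly_mult G0 f0)
  finally show ?thesis .
qed

section \<open>Matrices of prime order\<close>

text \<open>
  The coefficients of \<open>f\<close> are those of a linear relation between the \<open>N + 1\<close> vectors
  \<open>u 0, \<dots>, u N\<close> of length \<open>N\<close>. It is a kernel vector of the square matrix with these columns,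
  which is singular because a zero row has been added to it.
\<close>
lemma linear_dependence_poly:
  fixes u :: "nat \<Rightarrow> nat \<Rightarrow> 'a::field"
  obtains f :: "'a poly" where "f \<noteq> 0" "degree f \<le> N"
    "\<And>r. r < N \<Longrightarrow> (\<Sum>i\<le>N. coeff f i * u i r) = 0"
proof -
  define M where "M = mat (Suc N) (Suc N) (\<lambda>(r, i). if r < N then u i r else 0)"
  have M: "M \<in> carrier_mat (Suc N) (Suc N)"
    by (simp add: M_def)
  have "M = mat\<^sub>r (Suc N) (Suc N) (\<lambda>r. if r = N then 0\<^sub>v (Suc N) else row M r)"
    by (rule eq_matI) (auto simp: M_def less_Suc_eq)
  hence "det M = 0"
    using det_row_0[of N "Suc N" "row M"] M by auto
  then obtain v where v: "v \<in> carrier_vec (Suc N)" "v \<noteq> 0\<^sub>v (Suc N)" "M *\<^sub>v v = 0\<^sub>v (Suc N)"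
    using det_0_iff_vec_prod_zero_field[OF M] by blast
  define f where "f = (\<Sum>i\<le>N. monom (v $ i) i)"
  have coeff_f: "coeff f i = (if i \<le> N then v $ i else 0)" for i
    by (auto simp: f_def coeff_sum)
  have "\<exists>i\<le>N. v $ i \<noteq> 0"
  proof (rule ccontr)
    assume "\<not> (\<exists>i\<le>N. v $ i \<noteq> 0)"
    hence "v = 0\<^sub>v (Suc N)"
      using v(1) by (intro eq_vecI) auto
    thus False
      using v(2) by simp
  qed
  then obtain i where "i \<le> N" "v $ i \<noteq> 0"
    by blast
  hence "f \<noteq> 0"
    using coeff_f[of i] by auto
  moreover have "degree f \<le> N"
    by (rule degree_le) (simp add: coeff_f)
  moreover have "(\<Sum>i\<le>N. coeff f i * u i r) = 0" if r: "r < N" for r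
  proof -
    have "(\<Sum>i\<le>N. coeff f i * u i r) = (M *\<^sub>v v) $ r"
      using r v(1) by (auto simp: M_def coeff_f scalar_prod_def atLeast0LessThan lessThan_Suc_atMost
          mult.commute intro!: sum.cong)
    thus ?thesis
      using r v(3) by simp
  qed
  ultimately show thesis
    by (rule that)
qed

text \<open>
  The vectors \<open>u n\<close> in the proof are the \<open>s\<close>-th columns of \<open>B\<^sup>n (B - I)\<close>. Since \<open>B\<close> maps each of
  them to the next, a linear relation between \<open>u 0, \<dots>, u N\<close> remains true after any shift of the
  indices, and so becomes a linear recurrence for each coordinate.
\<close>
lemma prime_order_mat_bound:
  fixes B :: "rat mat"
  assumes B: "B \<in> carrier_mat N N" and q: "prime q" and Bq: "B ^\<^sub>m q = 1\<^sub>m N" and B1: "B \<noteq> 1\<^sub>m N"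
  shows "q \<le> N + 1"
proof (rule ccontr)
  assume "\<not> q \<le> N + 1"
  hence N: "N < q - 1"
    by simp
  have "\<exists>r<N. \<exists>s<N. B $$ (r, s) \<noteq> 1\<^sub>m N $$ (r, s)"
    using B1 B eq_matI[of "1\<^sub>m N" B] by (metis carrier_matD index_one_mat(2,3))
  then obtain r s where rs: "r < N" "s < N" "B $$ (r, s) \<noteq> 1\<^sub>m N $$ (r, s)"
    by blast
  define u where "u n k = (B ^\<^sub>m Suc n) $$ (k, s) - (B ^\<^sub>m n) $$ (k, s)" for n k
  have pow_step: "(B ^\<^sub>m Suc n) $$ (k, s) = (\<Sum>l<N. B $$ (k, l) * (B ^\<^sub>m n) $$ (l, s))"
    if "k < N" for k n
  proof -
    have "B ^\<^sub>m Suc n = B * B ^\<^sub>m n"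
      using pow_mat_add[OF B, of 1 n] B by simp
    thus ?thesis
      using that rs B by (simp add: scalar_prod_def atLeast0LessThan)
  qed
  have step: "u (Suc n) k = (\<Sum>l<N. B $$ (k, l) * u n l)" if "k < N" for n k
    unfolding u_def pow_step[OF that] by (simp add: sum_subtractf algebra_simps)
  obtain f where f: "f \<noteq> 0" "degree f \<le> N" "\<And>k. k < N \<Longrightarrow> (\<Sum>i\<le>N. coeff f i * u i k) = 0"
    using linear_dependence_poly[of N u] by metis
  have "(\<Sum>i\<le>N. coeff f i * u (n + i) k) = 0" if "k < N" for n k
    using that
  proof (induction n arbitrary: k)
    case (Suc n)
    have "(\<Sum>i\<le>N. coeff f i * u (Suc n + i) k)
      = (\<Sum>i\<le>N. \<Sum>l<N. B $$ (k, l) * (coeff f i * u (n + i) l))"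
      using Suc.prems by (simp add: step sum_distrib_left algebra_simps)
    also have "\<dots> = (\<Sum>l<N. B $$ (k, l) * (\<Sum>i\<le>N. coeff f i * u (n + i) l))"
      by (subst sum.swap) (simp add: sum_distrib_left)
    finally show ?case
      using Suc.IH by simp
  qed (simp add: f(3))
  hence annihilated: "shift_poly f (\<lambda>n. u n r) n = 0" for n
    using f(2) rs(1) by (simp add: shift_poly_altdef[of f N])
  have "(\<Sum>i<q. u (n + i) r) = 0" for n
  proof -
    have "(\<Sum>i<q. u (n + i) r) = (B ^\<^sub>m (n + q)) $$ (r, s) - (B ^\<^sub>m n) $$ (r, s)"
      using sum_lessThan_telescope[of "\<lambda>i. (B ^\<^sub>m (n + i)) $$ (r, s)" q] by (simp add: u_def)
    also have "\<dots> = 0"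
      using B by (simp add: pow_mat_add[OF B] Bq)
    finally show ?thesis .
  qed
  hence "u 0 r = 0"
    using geometric_recurrence_imp_zero[OF q f(1) _ _ annihilated] f(2) N by simp
  thus False
    using rs B by (simp add: u_def)
qed

section \<open>A symplectic matrix of odd order\<close>

text \<open>
  These are the three independent block equations contained in \<open>A\<^sup>T J A = J\<close>; the remaining block is
  minus the transpose of the last of them. The transposed products are kept in this form because
  for \<open>chain_rotation\<close> only multiplication by \<open>X\<^sup>T\<close> and \<open>Y\<^sup>T\<close> is sparse.
\<close>
lemma Sp_int_four_blockI:
  assumes X: "X \<in> carrier_mat g g" and Y: "Y \<in> carrier_mat g g"
    and Z: "Z \<in> carrier_mat g g" and W: "W \<in> carrier_mat g g"
    and XZ: "(X\<^sup>T * Z)\<^sup>T = X\<^sup>T * Z" and YW: "(Y\<^sup>T * W)\<^sup>T = Y\<^sup>T * W"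
    and XW: "X\<^sup>T * W - (Y\<^sup>T * Z)\<^sup>T = 1\<^sub>m g"
  shows "four_block_mat X Y Z W \<in> Sp_int g"
proof -
  have T: "(four_block_mat X Y Z W)\<^sup>T = four_block_mat X\<^sup>T Z\<^sup>T Y\<^sup>T W\<^sup>T"
    by (rule transpose_four_block_mat[OF X Y Z W])
  have "symp_form g * four_block_mat X Y Z W = four_block_mat
      (0\<^sub>m g g * X + 1\<^sub>m g * Z) (0\<^sub>m g g * Y + 1\<^sub>m g * W)
      (- 1\<^sub>m g * X + 0\<^sub>m g g * Z) (- 1\<^sub>m g * Y + 0\<^sub>m g g * W)"
    unfolding symp_form_def by (rule mult_four_block_mat[OF _ _ _ _ X Y Z W]) auto
  hence J: "symp_form g * four_block_mat X Y Z W = four_block_mat Z W (- X) (- Y)"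
    using X Y Z W by simp
  have XZ': "X\<^sup>T * Z + Z\<^sup>T * (- X) = 0\<^sub>m g g"
    using X Z XZ add_uminus_minus_mat[of "X\<^sup>T * Z" g g] by (simp add: transpose_mult[of "X\<^sup>T" g g Z g])
  have YW': "Y\<^sup>T * W + W\<^sup>T * (- Y) = 0\<^sub>m g g"
    using Y W YW add_uminus_minus_mat[of "Y\<^sup>T * W" g g] by (simp add: transpose_mult[of "Y\<^sup>T" g g W g])
  have XW': "X\<^sup>T * W + Z\<^sup>T * (- Y) = 1\<^sub>m g"
    using X Y Z W XW by (simp add: transpose_mult[of "Y\<^sup>T" g g Z g] add_uminus_minus_mat[of _ g g])
  have "(X\<^sup>T * W - (Y\<^sup>T * Z)\<^sup>T)\<^sup>T = W\<^sup>T * X - Y\<^sup>T * Z"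
    using X Y Z W by (simp add: transpose_minus[of _ g g] transpose_mult[of "X\<^sup>T" g g W g])
  hence WX: "W\<^sup>T * X - Y\<^sup>T * Z = 1\<^sub>m g"
    by (simp add: XW)
  have YZ: "Y\<^sup>T * Z + W\<^sup>T * (- X) = - 1\<^sub>m g"
    unfolding WX[symmetric] using X Y Z W by (intro eq_matI) auto
  have "(four_block_mat X Y Z W)\<^sup>T * (symp_form g * four_block_mat X Y Z W)
    = four_block_mat (X\<^sup>T * Z + Z\<^sup>T * (- X)) (X\<^sup>T * W + Z\<^sup>T * (- Y))
      (Y\<^sup>T * Z + W\<^sup>T * (- X)) (Y\<^sup>T * W + W\<^sup>T * (- Y))"
    unfolding T J using X Y Z W by (intro mult_four_block_mat) auto
  hence "(four_block_mat X Y Z W)\<^sup>T * (symp_form g * four_block_mat X Y Z W) = symp_form g"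
    by (simp add: XZ' YW' XW' YZ symp_form_def)
  moreover have "symp_form g \<in> carrier_mat (g + g) (g + g)"
    unfolding symp_form_def by (rule four_block_carrier_mat) auto
  moreover have "four_block_mat X Y Z W \<in> carrier_mat (g + g) (g + g)"
    using X W by (rule four_block_carrier_mat)
  ultimately show ?thesis
    by (simp add: Sp_int_def mult_2 assoc_mult_mat[of _ "g + g" "g + g" _ "g + g" _ "g + g"])
qed

text \<open>
  The blocks of the matrix that permutes the \<open>e\<^sub>n\<close> cyclically, written in the symplectic basis
  \<open>a\<^sub>i = e\<^sub>0 + e\<^sub>2 + \<dots> + e\<^sub>2\<^sub>i\<close>, \<open>b\<^sub>i = e\<^sub>2\<^sub>i\<^sub>+\<^sub>1\<close>. For \<open>i < k\<close> the permutation sends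
  \<open>a\<^sub>i\<close> to \<open>b\<^sub>0 + \<dots> + b\<^sub>i\<close>, and \<open>b\<^sub>i\<close> to \<open>e\<^sub>2\<^sub>i\<^sub>+\<^sub>2\<close>, which is \<open>a\<^sub>i\<^sub>+\<^sub>1 - a\<^sub>i\<close> if \<open>i + 1 < k\<close>,
  and \<open>- a\<^sub>i - (b\<^sub>0 + \<dots> + b\<^sub>i)\<close> if \<open>i + 1 = k\<close>. The basis vectors with index at least \<open>k\<close> are fixed.
  In the names, the first letter stands for the rows and the second for the columns.
\<close>
definition rot_aa :: "nat \<Rightarrow> nat \<Rightarrow> int mat" where
  "rot_aa g k = mat g g (\<lambda>(i, j). if i = j \<and> k \<le> j then 1 else 0)"

definition rot_ab :: "nat \<Rightarrow> nat \<Rightarrow> int mat" where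
  "rot_ab g k = mat g g (\<lambda>(i, j).
     (if i = Suc j \<and> Suc j < k then 1 else 0) - (if i = j \<and> j < k then 1 else 0))"

definition rot_ba :: "nat \<Rightarrow> nat \<Rightarrow> int mat" where
  "rot_ba g k = mat g g (\<lambda>(i, j). if i \<le> j \<and> j < k then 1 else 0)"

definition rot_bb :: "nat \<Rightarrow> nat \<Rightarrow> int mat" where
  "rot_bb g k = mat g g (\<lambda>(i, j).
     (if i = j \<and> k \<le> j then 1 else 0) - (if i < k \<and> Suc j = k then 1 else 0))"

lemmas rot_defs = rot_aa_def rot_ab_def rot_ba_def rot_bb_def

lemma rot_carrier [simp]:
  "rot_aa g k \<in> carrier_mat g g" "rot_ab g k \<in> carrier_mat g g"
  "rot_ba g k \<in> carrier_mat g g" "rot_bb g k \<in> carrier_mat g g"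
  by (simp_all add: rot_defs)

lemma rot_dim [simp]:
  "dim_row (rot_aa g k) = g" "dim_col (rot_aa g k) = g" "dim_row (rot_ab g k) = g" "dim_col (rot_ab g k) = g"
  "dim_row (rot_ba g k) = g" "dim_col (rot_ba g k) = g" "dim_row (rot_bb g k) = g" "dim_col (rot_bb g k) = g"
  by (simp_all add: rot_defs)

definition chain_rotation :: "nat \<Rightarrow> nat \<Rightarrow> int mat" where
  "chain_rotation g k = four_block_mat (rot_aa g k) (rot_ab g k) (rot_ba g k) (rot_bb g k)"

lemma chain_rotation_carrier [simp]: "chain_rotation g k \<in> carrier_mat (2 * g) (2 * g)"
  unfolding chain_rotation_def mult_2 by (rule four_block_carrier_mat) auto

lemma transpose_rot_aa_mult:
  assumes "P \<in> carrier_mat g g" "i < g" "j < g"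
  shows "((rot_aa g k)\<^sup>T * P) $$ (i, j) = (if k \<le> i then P $$ (i, j) else 0)"
proof -
  have "((rot_aa g k)\<^sup>T * P) $$ (i, j) = (\<Sum>l<g. rot_aa g k $$ (l, i) * P $$ (l, j))"
    using assms by (simp add: scalar_prod_def atLeast0LessThan)
  also have "\<dots> = (\<Sum>l<g. if l = i then if k \<le> i then P $$ (i, j) else 0 else 0)"
    using assms by (intro sum.cong) (auto simp: rot_aa_def)
  finally show ?thesis
    using assms by simp
qed

lemma transpose_rot_ab_mult:
  assumes "P \<in> carrier_mat g g" "i < g" "j < g" "k \<le> g"
  shows "((rot_ab g k)\<^sup>T * P) $$ (i, j)
    = (if Suc i < k then P $$ (Suc i, j) else 0) - (if i < k then P $$ (i, j) else 0)"
proof -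
  have "((rot_ab g k)\<^sup>T * P) $$ (i, j) = (\<Sum>l<g. rot_ab g k $$ (l, i) * P $$ (l, j))"
    using assms by (simp add: scalar_prod_def atLeast0LessThan)
  also have "\<dots> = (\<Sum>l<g. (if l = Suc i then if Suc i < k then P $$ (Suc i, j) else 0 else 0)
      - (if l = i then if i < k then P $$ (i, j) else 0 else 0))"
    using assms by (intro sum.cong) (auto simp: rot_ab_def)
  finally show ?thesis
    using assms by (simp add: sum_subtractf)
qed

lemma chain_rotation_in_Sp_int:
  assumes k: "k \<le> g"
  shows "chain_rotation g k \<in> Sp_int g"
  unfolding chain_rotation_def
proof (rule Sp_int_four_blockI)
  show "((rot_aa g k)\<^sup>T * rot_ba g k)\<^sup>T = (rot_aa g k)\<^sup>T * rot_ba g k"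
    by (rule eq_matI) (simp_all add: transpose_rot_aa_mult del: index_mult_mat(1), simp add: rot_ba_def)
  show "((rot_ab g k)\<^sup>T * rot_bb g k)\<^sup>T = (rot_ab g k)\<^sup>T * rot_bb g k"
    using k by (intro eq_matI)
      (simp_all add: transpose_rot_ab_mult del: index_mult_mat(1), auto simp: rot_bb_def)
  show "(rot_aa g k)\<^sup>T * rot_bb g k - ((rot_ab g k)\<^sup>T * rot_ba g k)\<^sup>T = 1\<^sub>m g"
    using k by (intro eq_matI)
      (simp_all add: transpose_rot_aa_mult transpose_rot_ab_mult del: index_mult_mat(1),
       auto simp: rot_ba_def rot_bb_def)
qed simp_all

text \<open>
  The same linear map in coordinates: \<open>x\<close> are the coordinates with respect to the \<open>a\<^sub>i\<close> and \<open>y\<close>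
  those with respect to the \<open>b\<^sub>i\<close>.
\<close>
lemma chain_rotation_mult_vec:
  assumes k: "0 < k" "k \<le> g"
  shows "chain_rotation g k *\<^sub>v (vec g x @\<^sub>v vec g y)
    = vec g (\<lambda>i. if i < k then (if i = 0 then 0 else y (i - 1)) - y i else x i)
      @\<^sub>v vec g (\<lambda>i. if i < k then (\<Sum>j\<in>{i..<k}. x j) - y (k - 1) else y i)"
proof -
  have mult_vec: "(P *\<^sub>v vec g z) $ i = (\<Sum>l<g. P $$ (i, l) * z l)"
    if "P \<in> carrier_mat g g" "i < g" for P :: "int mat" and z i
    using that by (simp add: scalar_prod_def atLeast0LessThan)
  have aa: "(\<Sum>l<g. rot_aa g k $$ (i, l) * x l) = (if k \<le> i then x i else 0)" if "i < g" for i
  proof -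
    have "(\<Sum>l<g. rot_aa g k $$ (i, l) * x l) = (\<Sum>l<g. if l = i then if k \<le> i then x i else 0 else 0)"
      using that by (intro sum.cong) (auto simp: rot_aa_def)
    thus ?thesis
      using that by simp
  qed
  have ab: "(\<Sum>l<g. rot_ab g k $$ (i, l) * y l)
      = (if i < k then (if i = 0 then 0 else y (i - 1)) - y i else 0)" if "i < g" for i
  proof -
    \<comment> \<open>\<open>i \<noteq> 0\<close> excludes the truncated difference \<open>0 - 1 = 0\<close>.\<close>
    have "(\<Sum>l<g. rot_ab g k $$ (i, l) * y l)
      = (\<Sum>l<g. (if l = i - 1 then if i < k \<and> i \<noteq> 0 then y (i - 1) else 0 else 0)
      - (if l = i then if i < k then y i else 0 else 0))"
      using that by (intro sum.cong) (auto simp: rot_ab_def)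
    thus ?thesis
      using that by (simp add: sum_subtractf less_imp_diff_less)
  qed
  have ba: "(\<Sum>l<g. rot_ba g k $$ (i, l) * x l) = (if i < k then \<Sum>j\<in>{i..<k}. x j else 0)"
    if "i < g" for i
  proof -
    have "(\<Sum>l<g. rot_ba g k $$ (i, l) * x l) = (\<Sum>l\<in>{i..<k}. x l)"
      using that k by (intro sum.mono_neutral_cong_right) (auto simp: rot_ba_def)
    thus ?thesis
      by simp
  qed
  have bb: "(\<Sum>l<g. rot_bb g k $$ (i, l) * y l) = (if i < k then - y (k - 1) else y i)"
    if "i < g" for i
  proof -
    have "(\<Sum>l<g. rot_bb g k $$ (i, l) * y l) = (\<Sum>l<g. (if l = i then if k \<le> i then y i else 0 else 0)
      - (if l = k - 1 then if i < k then y (k - 1) else 0 else 0))"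
      using that k by (intro sum.cong) (auto simp: rot_bb_def)
    thus ?thesis
      using that k by (auto simp: sum_subtractf)
  qed
  have "chain_rotation g k *\<^sub>v (vec g x @\<^sub>v vec g y)
    = (rot_aa g k *\<^sub>v vec g x + rot_ab g k *\<^sub>v vec g y)
      @\<^sub>v (rot_ba g k *\<^sub>v vec g x + rot_bb g k *\<^sub>v vec g y)"
    unfolding chain_rotation_def by (rule four_block_mat_mult_vec[of _ g g _ g _ g]) auto
  moreover have "rot_aa g k *\<^sub>v vec g x + rot_ab g k *\<^sub>v vec g y
      = vec g (\<lambda>i. if i < k then (if i = 0 then 0 else y (i - 1)) - y i else x i)"
    by (rule eq_vecI) (auto simp: mult_vec aa ab simp del: index_mult_mat_vec)
  moreover have "rot_ba g k *\<^sub>v vec g x + rot_bb g k *\<^sub>v vec g y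
      = vec g (\<lambda>i. if i < k then (\<Sum>j\<in>{i..<k}. x j) - y (k - 1) else y i)"
    by (rule eq_vecI) (auto simp: mult_vec ba bb simp del: index_mult_mat_vec)
  ultimately show ?thesis
    by simp
qed


abbreviation split_vec :: "nat \<Rightarrow> (nat \<Rightarrow> 'a) \<Rightarrow> (nat \<Rightarrow> 'a) \<Rightarrow> 'a vec" where
  "split_vec g x y \<equiv> vec g x @\<^sub>v vec g y"

lemma split_vec_cong:
  assumes "\<And>i. i < g \<Longrightarrow> x i = x' i" "\<And>i. i < g \<Longrightarrow> y i = y' i"
  shows "split_vec g x y = split_vec g x' y'"
  using assms by (intro eq_vecI) auto

text \<open>
  The coordinates of \<open>e\<^sub>n\<close> for \<open>n \<le> 2k\<close>: \<open>e\<^sub>2\<^sub>i = a\<^sub>i - a\<^sub>i\<^sub>-\<^sub>1\<close> and \<open>e\<^sub>2\<^sub>i\<^sub>+\<^sub>1 = b\<^sub>i\<close> for \<open>i < k\<close>, and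
  \<open>e\<^sub>2\<^sub>k = - a\<^sub>k\<^sub>-\<^sub>1 - (b\<^sub>0 + \<dots> + b\<^sub>k\<^sub>-\<^sub>1)\<close>. The conjunct \<open>i < k\<close> in the first component drops the
  term \<open>a\<^sub>k\<close> that the formula for \<open>e\<^sub>2\<^sub>i\<close> would contribute for \<open>i = k\<close>.
\<close>
definition chain_vec :: "nat \<Rightarrow> nat \<Rightarrow> nat \<Rightarrow> int vec" where
  "chain_vec g k n = split_vec g
     (\<lambda>i. if even n then (if i = n div 2 \<and> i < k then 1 else 0) - (if Suc i = n div 2 then 1 else 0) else 0)
     (\<lambda>i. if odd n then (if i = n div 2 then 1 else 0) else (if n = 2 * k \<and> i < k then - 1 else 0))"

lemma chain_vec_carrier [simp]: "chain_vec g k n \<in> carrier_vec (2 * g)"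
  unfolding chain_vec_def mult_2 by (rule append_carrier_vec) auto

lemma chain_rotation_chain_vec:
  assumes k: "k \<le> g" and n: "n < 2 * k"
  shows "chain_rotation g k *\<^sub>v chain_vec g k n = chain_vec g k (Suc n)"
proof -
  have k0: "0 < k"
    using n by simp
  show ?thesis
  proof (cases "even n")
    case True
    then obtain i where i: "n = 2 * i"
      by (elim evenE)
    have ik: "i < k"
      using i n by simp
    have sum: "(\<Sum>j\<in>{r..<k}. (if j = i then 1 else 0) - (if Suc j = i then 1 else 0))
      = (if r = i then 1 else 0 :: int)" for r
    proof -
      have "(\<Sum>j\<in>{r..<k}. if Suc j = i then 1 else 0 :: int)
        = (\<Sum>j\<in>{r..<k}. if j = i - 1 then (if i = 0 then 0 else 1) else 0)"
        by (intro sum.cong) auto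
      thus ?thesis
        using ik by (auto simp: sum_subtractf)
    qed
    show ?thesis
      unfolding chain_vec_def chain_rotation_mult_vec[OF k0 k] i
      using ik by (intro split_vec_cong) (auto simp: sum)
  next
    case False
    then obtain i where i: "n = 2 * i + 1"
      by (elim oddE)
    show ?thesis
      unfolding chain_vec_def chain_rotation_mult_vec[OF k0 k] i
      using n by (intro split_vec_cong) (auto simp: i)
  qed
qed

lemma chain_rotation_chain_vec_last:
  assumes k: "0 < k" "k \<le> g"
  shows "chain_rotation g k *\<^sub>v chain_vec g k (2 * k) = chain_vec g k 0"
proof -
  have sum: "(\<Sum>j\<in>{r..<k}. - (if Suc j = k then 1 else 0)) = (if r < k then - 1 else 0 :: int)" for r
  proof -
    have "(\<Sum>j\<in>{r..<k}. - (if Suc j = k then 1 else 0)) = (\<Sum>j\<in>{r..<k}. if j = k - 1 then - 1 else 0 :: int)"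
      using k by (intro sum.cong) auto
    thus ?thesis
      using k by auto
  qed
  show ?thesis
    unfolding chain_vec_def chain_rotation_mult_vec[OF k]
    using k by (intro split_vec_cong) (auto simp: sum)
qed

lemma pow_mat_chain_vec:
  assumes k: "k \<le> g" and n: "n \<le> 2 * k"
  shows "chain_rotation g k ^\<^sub>m n *\<^sub>v chain_vec g k 0 = chain_vec g k n"
  using n
proof (induction n)
  case (Suc n)
  have "chain_rotation g k ^\<^sub>m Suc n = chain_rotation g k * chain_rotation g k ^\<^sub>m n"
    using pow_mat_add[OF chain_rotation_carrier, of g k 1 n] carrier_matD[OF chain_rotation_carrier, of g k]
    by simp
  thus ?case
    using Suc chain_rotation_chain_vec[OF k, of n]
    by (simp add: assoc_mult_mat_vec[of _ "2 * g" "2 * g" _ "2 * g"])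
qed (use carrier_matD[OF chain_rotation_carrier, of g k] in simp)

text \<open>
  The vector \<open>e\<^sub>0\<close> runs through the whole cycle and returns to itself. Each \<open>e\<^sub>n\<close> is the image of
  \<open>e\<^sub>0\<close> under a power of the matrix, which commutes with the power considered here.
\<close>
lemma chain_rotation_power_fixes_chain_vec:
  assumes k: "0 < k" "k \<le> g" and n: "n \<le> 2 * k"
  shows "chain_rotation g k ^\<^sub>m (2 * k + 1) *\<^sub>v chain_vec g k n = chain_vec g k n"
proof -
  let ?A = "chain_rotation g k" and ?e = "chain_vec g k"
  note add = pow_mat_add[OF chain_rotation_carrier, of g k]
  have dim: "dim_row ?A = 2 * g"
    using carrier_matD[OF chain_rotation_carrier, of g k] by simp
  have "?A ^\<^sub>m (2 * k + 1) = ?A * ?A ^\<^sub>m (2 * k)"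
    using add[of 1 "2 * k"] dim by simp
  hence 0: "?A ^\<^sub>m (2 * k + 1) *\<^sub>v ?e 0 = ?e 0"
    using chain_rotation_chain_vec_last[OF k] pow_mat_chain_vec[OF k(2), of "2 * k"]
    by (simp add: assoc_mult_mat_vec[of _ "2 * g" "2 * g" _ "2 * g"])
  have "?A ^\<^sub>m (2 * k + 1) * ?A ^\<^sub>m n = ?A ^\<^sub>m n * ?A ^\<^sub>m (2 * k + 1)"
    unfolding add[symmetric] by (simp add: add.commute)
  hence "?A ^\<^sub>m (2 * k + 1) *\<^sub>v (?A ^\<^sub>m n *\<^sub>v ?e 0) = ?A ^\<^sub>m n *\<^sub>v (?A ^\<^sub>m (2 * k + 1) *\<^sub>v ?e 0)"
    by (metis assoc_mult_mat_vec chain_rotation_carrier chain_vec_carrier pow_carrier_mat)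
  thus ?thesis
    using 0 pow_mat_chain_vec[OF k(2) n] by simp
qed

lemma pow_mat_fixes_vec:
  assumes A: "A \<in> carrier_mat n n" and v: "v \<in> carrier_vec n" and fixed: "A *\<^sub>v v = v"
  shows "A ^\<^sub>m i *\<^sub>v v = v"
  using assms by (induction i) (simp_all add: assoc_mult_mat_vec[of _ n n _ n])

text \<open>
  It remains to see that the fixed vectors \<open>e\<^sub>n\<close>, together with the basis vectors of index at least
  \<open>k\<close>, span the lattice: \<open>b\<^sub>j = e\<^sub>2\<^sub>j\<^sub>+\<^sub>1\<close>, and \<open>a\<^sub>j\<^sub>+\<^sub>1 = e\<^sub>2\<^sub>j\<^sub>+\<^sub>2 + a\<^sub>j\<close>.
\<close>
lemma chain_rotation_power:
  assumes k: "0 < k" "k \<le> g"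
  shows "chain_rotation g k ^\<^sub>m (2 * k + 1) = 1\<^sub>m (2 * g)"
proof -
  define P where "P = chain_rotation g k ^\<^sub>m (2 * k + 1)"
  have P: "P \<in> carrier_mat (2 * g) (2 * g)"
    by (simp add: P_def del: pow_mat.simps)
  have carrier: "split_vec g x y \<in> carrier_vec (2 * g)" for x y :: "nat \<Rightarrow> int"
    unfolding mult_2 by (rule append_carrier_vec) auto
  let ?a = "\<lambda>j. split_vec g (\<lambda>i. if i = j then 1 else 0 :: int) (\<lambda>i. 0)"
  let ?b = "\<lambda>j. split_vec g (\<lambda>i. 0) (\<lambda>i. if i = j then 1 else 0 :: int)"
  have fix_a: "P *\<^sub>v ?a j = ?a j" for j
  proof (cases "j < k")
    case True
    thus ?thesis
    proof (induction j)
      case 0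
      have "?a 0 = chain_vec g k 0"
        unfolding chain_vec_def using k by (intro split_vec_cong) auto
      thus ?case
        using chain_rotation_power_fixes_chain_vec[OF k, of 0] by (simp add: P_def del: pow_mat.simps)
    next
      case (Suc j)
      have eq: "?a (Suc j) = chain_vec g k (2 * Suc j) + ?a j"
        unfolding chain_vec_def using Suc.prems by (intro eq_vecI) auto
      have "P *\<^sub>v ?a (Suc j) = P *\<^sub>v chain_vec g k (2 * Suc j) + P *\<^sub>v ?a j"
        unfolding eq by (rule mult_add_distrib_mat_vec[OF P]) (auto intro: carrier)
      also have "P *\<^sub>v chain_vec g k (2 * Suc j) = chain_vec g k (2 * Suc j)"
        unfolding P_def using Suc.prems by (intro chain_rotation_power_fixes_chain_vec[OF k]) simp
      also have "P *\<^sub>v ?a j = ?a j"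
        using Suc by simp
      finally show ?case
        using eq by simp
    qed
  next
    case False
    hence "chain_rotation g k *\<^sub>v ?a j = ?a j"
      unfolding chain_rotation_mult_vec[OF k] by (intro split_vec_cong) auto
    thus ?thesis
      unfolding P_def by (intro pow_mat_fixes_vec[OF chain_rotation_carrier carrier])
  qed
  have fix_b: "P *\<^sub>v ?b j = ?b j" for j
  proof (cases "j < k")
    case True
    have "?b j = chain_vec g k (2 * j + 1)"
      unfolding chain_vec_def by (intro split_vec_cong) auto
    thus ?thesis
      using chain_rotation_power_fixes_chain_vec[OF k, of "2 * j + 1"] True
      by (simp add: P_def del: pow_mat.simps)
  next
    case False
    hence "chain_rotation g k *\<^sub>v ?b j = ?b j"
      unfolding chain_rotation_mult_vec[OF k] by (intro split_vec_cong) auto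
    thus ?thesis
      unfolding P_def by (intro pow_mat_fixes_vec[OF chain_rotation_carrier carrier])
  qed
  have "P = 1\<^sub>m (2 * g)"
  proof (rule mat_col_eqI)
    fix j
    assume "j < dim_col (1\<^sub>m (2 * g) :: int mat)"
    hence j: "j < 2 * g"
      by simp
    have "unit_vec (2 * g) j = (if j < g then ?a j else ?b (j - g))"
      using j by (intro eq_vecI) auto
    hence "P *\<^sub>v unit_vec (2 * g) j = unit_vec (2 * g) j"
      using fix_a fix_b by simp
    moreover have "P *\<^sub>v unit_vec (2 * g) j = col P j"
      using P j by (intro eq_vecI) (auto simp: scalar_prod_right_unit)
    ultimately show "col P j = col (1\<^sub>m (2 * g)) j"
      using j by simp
  qed (use P in auto)
  thus ?thesis
    by (simp add: P_def)
qed

lemma chain_rotation_neq_one: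
  assumes k: "0 < k" "k \<le> g"
  shows "chain_rotation g k \<noteq> 1\<^sub>m (2 * g)"
proof
  assume "chain_rotation g k = 1\<^sub>m (2 * g)"
  moreover have "chain_rotation g k $$ (0, 0) = 0"
    using k by (simp add: chain_rotation_def rot_aa_def)
  ultimately show False
    using k by simp
qed

lemma prime_order_element_in_Sp_int:
  assumes p: "prime p" "p \<le> 2 * g + 1" and g: "g \<ge> 1"
  obtains A where "A \<in> Sp_int g" "A \<noteq> 1\<^sub>m (2 * g)" "A ^\<^sub>m p = 1\<^sub>m (2 * g)"
proof (cases "p = 2")
  case True
  let ?A = "four_block_mat (- 1\<^sub>m g) (0\<^sub>m g g) (0\<^sub>m g g) (- 1\<^sub>m g) :: int mat"
  have A: "?A = - 1\<^sub>m (2 * g)"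
    by (rule eq_matI) auto
  show thesis
  proof
    show "- 1\<^sub>m (2 * g) \<in> Sp_int g"
      unfolding A[symmetric] by (rule Sp_int_four_blockI) (auto simp: transpose_uminus)
    have "(- 1\<^sub>m (2 * g) :: int mat) $$ (0, 0) \<noteq> 1\<^sub>m (2 * g) $$ (0, 0)"
      using g by simp
    thus "- 1\<^sub>m (2 * g) \<noteq> (1\<^sub>m (2 * g) :: int mat)"
      by metis
    show "(- 1\<^sub>m (2 * g) :: int mat) ^\<^sub>m p = 1\<^sub>m (2 * g)"
      by (simp add: True numeral_2_eq_2)
  qed
next
  case False
  hence "odd p"
    using p(1) prime_odd_nat prime_gt_1_nat[OF p(1)] by auto
  then obtain k where k: "p = 2 * k + 1"
    by (elim oddE)
  hence "0 < k" "k \<le> g"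
    using p prime_gt_1_nat[OF p(1)] by auto
  thus thesis
    using that[OF chain_rotation_in_Sp_int chain_rotation_neq_one] chain_rotation_power k by blast
qed

section \<open>Exponents of elements of the symplectic group\<close>

theorem theorem1p1:
  fixes g m :: nat
  assumes "g \<ge> 1" and "m > 0"
  shows "(\<exists>A \<in> Sp_int g. A \<noteq> 1\<^sub>m (2 * g) \<and> A ^\<^sub>m m = 1\<^sub>m (2 * g))
    \<longleftrightarrow> m \<in> admissible_exponents g"
proof
  assume "\<exists>A \<in> Sp_int g. A \<noteq> 1\<^sub>m (2 * g) \<and> A ^\<^sub>m m = 1\<^sub>m (2 * g)"
  then obtain A :: "int mat"
    where A: "A \<in> carrier_mat (2 * g) (2 * g)" "A \<noteq> 1\<^sub>m (2 * g)" "A ^\<^sub>m m = 1\<^sub>m (2 * g)"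
    by (auto simp: Sp_int_def)
  obtain q k where q: "prime q" "q dvd m"
    and k: "A ^\<^sub>m k \<noteq> 1\<^sub>m (2 * g)" "(A ^\<^sub>m k) ^\<^sub>m q = 1\<^sub>m (2 * g)"
    using prime_order_power[OF A(1) assms(2) A(3,2)] by blast
  let ?B = "map_mat rat_of_int (A ^\<^sub>m k)"
  have Ak: "A ^\<^sub>m k \<in> carrier_mat (2 * g) (2 * g)"
    using A(1) by simp
  have "q \<le> 2 * g + 1"
  proof (rule prime_order_mat_bound[OF _ q(1)])
    show "?B \<in> carrier_mat (2 * g) (2 * g)"
      using Ak by simp
    show "?B ^\<^sub>m q = 1\<^sub>m (2 * g)"
      using k(2) by (simp add: of_int_hom.mat_hom_pow[OF Ak, symmetric] of_int_hom.mat_hom_one)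
    show "?B \<noteq> 1\<^sub>m (2 * g)"
      using k(1) of_int_hom.mat_hom_inj[of "A ^\<^sub>m k" "1\<^sub>m (2 * g)"]
      by (auto simp: of_int_hom.mat_hom_one)
  qed
  thus "m \<in> admissible_exponents g"
    using q assms(2) by (auto simp: admissible_exponents_def)
next
  assume "m \<in> admissible_exponents g"
  then obtain p where p: "prime p" "p dvd m" "p \<le> 2 * g + 1"
    by (auto simp: admissible_exponents_def)
  obtain A where A: "A \<in> Sp_int g" "A \<noteq> 1\<^sub>m (2 * g)" "A ^\<^sub>m p = 1\<^sub>m (2 * g)"
    using prime_order_element_in_Sp_int[OF p(1,3) assms(1)] by blast
  obtain l where "m = p * l"
    using p(2) by (elim dvdE)
  moreover have "A \<in> carrier_mat (2 * g) (2 * g)"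
    using A(1) by (simp add: Sp_int_def)
  ultimately have "A ^\<^sub>m m = 1\<^sub>m (2 * g)"
    by (simp add: pow_mat_mult A(3) one_pow_mat)
  thus "\<exists>A \<in> Sp_int g. A \<noteq> 1\<^sub>m (2 * g) \<and> A ^\<^sub>m m = 1\<^sub>m (2 * g)"
    using A by blast
qed

end
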